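(* Consider the overall system optimization problem $$\min_{(f,x,q,d,h)\in K_1\times K_2}\ \tfrac1\alpha\sum_{r\in O}\sum_{s\in D}\sum_{k\in R_{rs}}f_k^{rs}(\ln f_k^{rs}-1)+\left(\tfrac1\gamma-\tfrac1\alpha\right)\sum_{r\in O}\sum_{s\in D}q_{rs}(\ln q_{rs}-1)+\tfrac1\beta\sum_{s\in D}h_s(\ln h_s-1)+\sum_{a\in A}x_at_a(x_a)-\sum_{s\in D}A_s(d_s,h_s)d_s-\sum_{s\in D}B_s(d_s,h_s)h_s$$ (the total social cost of travelers and companies). Then there exists an optimal congestion pricing scheme, consisting of road pricing and business congestion tax, that supports an overall system optimum as a combined equilibrium, in the following sense: the problem has a global optimal solution; and if $(f,x,q,d,h)$ is any global optimal solution and one imposes the constant charges (subsidies when negative) $$\tau_a=x_a\frac{dt_a(x_a)}{dx_a}\ (a\in A),\qquad u_s=-\left[d_s\frac{\partial A_s(d_s,h_s)}{\partial d_s}+h_s\frac{\partial B_s(d_s,h_s)}{\partial d_s}\right],\qquad w_s=-\left[d_s\frac{\partial A_s(d_s,h_s)}{\partial h_s}+h_s\frac{\partial B_s(d_s,h_s)}{\partial h_s}\right]\ (s\in D)$$ on, respectively, each traveler using link $a$, each traveler entering business center $s$, and each company in business center $s$, then $(f,x,q,d,h)$ is a combined equilibrium of the system with charges, i.e. a combined equilibrium with respect to the link cost functions $t_a+\tau_a$, the trip attraction functions $A_s-u_s$ and the business attraction functions $B_s-w_s$.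
   Context: $G=(V,A)$ is a finite directed network with link set $A$, finite nonempty origin set $O$ and destination set $D$ (every destination is a business center). For $r\in O$, $s\in D$, $R_{rs}$ is the (finite, nonempty) set of simple routes from $r$ to $s$; $\delta_{ak}^{rs}=1$ if link $a$ lies on route $k\in R_{rs}$ and $0$ otherwise. $O_r>0$ is the fixed travel demand from origin $r$, and $T>0$ is the fixed total number of business companies. Variables: path flows $f=(f_k^{rs})$, link flows $x=(x_a)$, origin-destination demands $q=(q_{rs})$, destination demands $d=(d_s)$, business flows $h=(h_s)$. $$K_1=\Big\{(f,x,q,d): f_k^{rs}\ge0,\ \sum_{k\in R_{rs}}f_k^{rs}=q_{rs},\ \sum_{s\in D}q_{rs}=O_r,\ \sum_{r\in O}\sum_{s\in D}\sum_{k\in R_{rs}}\delta_{ak}^{rs}f_k^{rs}=x_a,\ \sum_{r\in O}q_{rs}=d_s\ \ \forall k\in R_{rs},r\in O,s\in D,a\in A\Big\},$$ $$K_2=\Big\{h: h_s\ge0\ \forall s\in D,\ \sum_{s\in D}h_s=T\Big\}.$$ Parameters: $\alpha,\beta,\gamma>0$ with $\alpha\ge\gamma$. Standing assumptions on functions of nonnegative real arguments: each link travel time $t_a(x_a)$ is convex, continuously differentiable and strictly increasing; each trip attraction function $A_s(d_s,h_s)$ is continuously differentiable, strictly decreasing and strictly concave in $d_s$, and strictly increasing in $h_s$; each business attraction function $B_s(d_s,h_s)$ is continuously differentiable, strictly increasing in $d_s$ and strictly decreasing in $h_s$. Convention: $0\ln0=0$. Definition: given link cost functions $\hat t_a$,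 trip attraction functions $\hat A_s$ and business attraction functions $\hat B_s$, a point $(f,x,q,d,h)\in K_1\times K_2$ is a (logit-based) combined equilibrium with respect to them if, for all $r\in O$, $s\in D$, $k\in R_{rs}$, $$q_{rs}=O_r\frac{\exp\{-\gamma[v_{rs}-\hat A_s(d_s,h_s)]\}}{\sum_{j\in D}\exp\{-\gamma[v_{rj}-\hat A_j(d_j,h_j)]\}},\quad f_k^{rs}=q_{rs}\frac{\exp\{-\alpha\sum_{a\in A}\delta_{ak}^{rs}\hat t_a(x_a)\}}{\sum_{j\in R_{rs}}\exp\{-\alpha\sum_{a\in A}\delta_{aj}^{rs}\hat t_a(x_a)\}},\quad h_s=T\frac{\exp[\beta\hat B_s(d_s,h_s)]}{\sum_{j\in D}\exp[\beta\hat B_j(d_j,h_j)]},$$ where $v_{rs}=-\frac1\alpha\ln\{\sum_{j\in R_{rs}}\exp[-\alpha\sum_{a\in A}\delta_{aj}^{rs}\hat t_a(x_a)]\}$. *)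

theory Defs
  imports "HOL-Analysis.Analysis" "Graph_Theory.Arc_Walk"
begin

text \<open>Functions of nonnegative arguments are represented by total functions whose values outside
  \<open>{0..}\<close> (or \<open>{0..} \<times> {0..}\<close>) are irrelevant: continuity and differentiability are always relative
  to that set, hence one-sided on its boundary.\<close>

definition continuously_differentiable_on ::
    "'a::real_normed_vector set \<Rightarrow> ('a \<Rightarrow> real) \<Rightarrow> bool" where
  "continuously_differentiable_on S f \<longleftrightarrow>
     (\<exists>f' :: 'a \<Rightarrow> 'a \<Rightarrow>\<^sub>L real. continuous_on S f' \<and>
        (\<forall>p\<in>S. (f has_derivative blinfun_apply (f' p)) (at p within S)))"

definition strictly_concave_on :: "'a::real_vector set \<Rightarrow> ('a \<Rightarrow> real) \<Rightarrow> bool" where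
  "strictly_concave_on S f \<longleftrightarrow> convex S \<and>
     (\<forall>x\<in>S. \<forall>y\<in>S. \<forall>\<theta>. x \<noteq> y \<longrightarrow> 0 < \<theta> \<longrightarrow> \<theta> < 1 \<longrightarrow>
        (1 - \<theta>) * f x + \<theta> * f y < f ((1 - \<theta>) *\<^sub>R x + \<theta> *\<^sub>R y))"

definition deriv_nonneg :: "(real \<Rightarrow> real) \<Rightarrow> real \<Rightarrow> real" where
  "deriv_nonneg f x = vector_derivative f (at x within {0..})"

definition link_travel_time :: "(real \<Rightarrow> real) \<Rightarrow> bool" where
  "link_travel_time t \<longleftrightarrow>
     convex_on {0..} t \<and> continuously_differentiable_on {0..} t \<and> strict_mono_on {0..} t"

definition trip_attraction :: "(real \<Rightarrow> real \<Rightarrow> real) \<Rightarrow> bool" where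
  "trip_attraction A \<longleftrightarrow>
     continuously_differentiable_on ({0..} \<times> {0..}) (\<lambda>(d, h). A d h) \<and>
     (\<forall>h\<ge>0. strict_antimono_on {0..} (\<lambda>d. A d h) \<and> strictly_concave_on {0..} (\<lambda>d. A d h)) \<and>
     (\<forall>d\<ge>0. strict_mono_on {0..} (\<lambda>h. A d h))"

definition business_attraction :: "(real \<Rightarrow> real \<Rightarrow> real) \<Rightarrow> bool" where
  "business_attraction B \<longleftrightarrow>
     continuously_differentiable_on ({0..} \<times> {0..}) (\<lambda>(d, h). B d h) \<and>
     (\<forall>h\<ge>0. strict_mono_on {0..} (\<lambda>d. B d h)) \<and>
     (\<forall>d\<ge>0. strict_antimono_on {0..} (\<lambda>h. B d h))"

text \<open>A simple route visits no vertex twice; in particular, if an origin is also a destination, the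
  only simple route from it to itself is the empty one.\<close>

definition routes :: "('v, 'a) pre_digraph \<Rightarrow> 'v \<Rightarrow> 'v \<Rightarrow> 'a awalk set" where
  "routes G r s = {k. pre_digraph.apath G r k s}"

definition incidence :: "'a \<Rightarrow> 'a awalk \<Rightarrow> real" where
  "incidence a k = (if a \<in> set k then 1 else 0)"

text \<open>Components at indices outside the network (e.g. \<open>f r s k\<close> with \<open>k \<notin> routes G r s\<close>) are
  unconstrained, and nothing below depends on them.\<close>

type_synonym ('v, 'a) traffic_state =
  "('v \<Rightarrow> 'v \<Rightarrow> 'a awalk \<Rightarrow> real) \<times> ('a \<Rightarrow> real) \<times> ('v \<Rightarrow> 'v \<Rightarrow> real) \<times> ('v \<Rightarrow> real)"

definition K1 ::
    "('v, 'a) pre_digraph \<Rightarrow> 'v set \<Rightarrow> 'v set \<Rightarrow> ('v \<Rightarrow> real) \<Rightarrow> ('v, 'a) traffic_state set" where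
  "K1 G Orig Dest Demand = {(f, x, q, d).
     (\<forall>r\<in>Orig. \<forall>s\<in>Dest. \<forall>k\<in>routes G r s. 0 \<le> f r s k) \<and>
     (\<forall>r\<in>Orig. \<forall>s\<in>Dest. (\<Sum>k\<in>routes G r s. f r s k) = q r s) \<and>
     (\<forall>r\<in>Orig. (\<Sum>s\<in>Dest. q r s) = Demand r) \<and>
     (\<forall>a\<in>arcs G. (\<Sum>r\<in>Orig. \<Sum>s\<in>Dest. \<Sum>k\<in>routes G r s. incidence a k * f r s k) = x a) \<and>
     (\<forall>s\<in>Dest. (\<Sum>r\<in>Orig. q r s) = d s)}"

definition K2 :: "'v set \<Rightarrow> real \<Rightarrow> ('v \<Rightarrow> real) set" where
  "K2 Dest T = {h. (\<forall>s\<in>Dest. 0 \<le> h s) \<and> (\<Sum>s\<in>Dest. h s) = T}"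

definition route_cost ::
    "('v, 'a) pre_digraph \<Rightarrow> ('a \<Rightarrow> real \<Rightarrow> real) \<Rightarrow> ('a \<Rightarrow> real) \<Rightarrow> 'a awalk \<Rightarrow> real" where
  "route_cost G t x k = (\<Sum>a\<in>arcs G. incidence a k * t a (x a))"

definition od_cost ::
    "('v, 'a) pre_digraph \<Rightarrow> real \<Rightarrow> ('a \<Rightarrow> real \<Rightarrow> real) \<Rightarrow> ('a \<Rightarrow> real) \<Rightarrow> 'v \<Rightarrow> 'v \<Rightarrow> real" where
  "od_cost G \<alpha> t x r s =
     - (1 / \<alpha>) * ln (\<Sum>j\<in>routes G r s. exp (- \<alpha> * route_cost G t x j))"

definition combined_equilibrium ::
    "('v, 'a) pre_digraph \<Rightarrow> 'v set \<Rightarrow> 'v set \<Rightarrow> ('v \<Rightarrow> real) \<Rightarrow> real \<Rightarrow> real \<Rightarrow> real \<Rightarrow> real \<Rightarrow>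
     ('a \<Rightarrow> real \<Rightarrow> real) \<Rightarrow> ('v \<Rightarrow> real \<Rightarrow> real \<Rightarrow> real) \<Rightarrow> ('v \<Rightarrow> real \<Rightarrow> real \<Rightarrow> real) \<Rightarrow>
     ('v, 'a) traffic_state \<times> ('v \<Rightarrow> real) \<Rightarrow> bool" where
  "combined_equilibrium G Orig Dest Demand T \<alpha> \<beta> \<gamma> t A B = (\<lambda>((f, x, q, d), h).
     ((f, x, q, d), h) \<in> K1 G Orig Dest Demand \<times> K2 Dest T \<and>
     (\<forall>r\<in>Orig. \<forall>s\<in>Dest.
        q r s = Demand r * (exp (- \<gamma> * (od_cost G \<alpha> t x r s - A s (d s) (h s))) /
          (\<Sum>j\<in>Dest. exp (- \<gamma> * (od_cost G \<alpha> t x r j - A j (d j) (h j)))))) \<and>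
     (\<forall>r\<in>Orig. \<forall>s\<in>Dest. \<forall>k\<in>routes G r s.
        f r s k = q r s * (exp (- \<alpha> * route_cost G t x k) /
          (\<Sum>j\<in>routes G r s. exp (- \<alpha> * route_cost G t x j)))) \<and>
     (\<forall>s\<in>Dest.
        h s = T * (exp (\<beta> * B s (d s) (h s)) / (\<Sum>j\<in>Dest. exp (\<beta> * B j (d j) (h j))))))"

text \<open>The convention \<open>0 ln 0 = 0\<close> holds automatically since \<open>ln\<close> is total.\<close>

definition total_social_cost ::
    "('v, 'a) pre_digraph \<Rightarrow> 'v set \<Rightarrow> 'v set \<Rightarrow> real \<Rightarrow> real \<Rightarrow> real \<Rightarrow>
     ('a \<Rightarrow> real \<Rightarrow> real) \<Rightarrow> ('v \<Rightarrow> real \<Rightarrow> real \<Rightarrow> real) \<Rightarrow> ('v \<Rightarrow> real \<Rightarrow> real \<Rightarrow> real) \<Rightarrow>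
     ('v, 'a) traffic_state \<times> ('v \<Rightarrow> real) \<Rightarrow> real" where
  "total_social_cost G Orig Dest \<alpha> \<beta> \<gamma> t A B = (\<lambda>((f, x, q, d), h).
     1 / \<alpha> * (\<Sum>r\<in>Orig. \<Sum>s\<in>Dest. \<Sum>k\<in>routes G r s. f r s k * (ln (f r s k) - 1))
     + (1 / \<gamma> - 1 / \<alpha>) * (\<Sum>r\<in>Orig. \<Sum>s\<in>Dest. q r s * (ln (q r s) - 1))
     + 1 / \<beta> * (\<Sum>s\<in>Dest. h s * (ln (h s) - 1))
     + (\<Sum>a\<in>arcs G. x a * t a (x a))
     - (\<Sum>s\<in>Dest. A s (d s) (h s) * d s)
     - (\<Sum>s\<in>Dest. B s (d s) (h s) * h s))"

definition system_optimum ::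
    "('v, 'a) pre_digraph \<Rightarrow> 'v set \<Rightarrow> 'v set \<Rightarrow> ('v \<Rightarrow> real) \<Rightarrow> real \<Rightarrow> real \<Rightarrow> real \<Rightarrow> real \<Rightarrow>
     ('a \<Rightarrow> real \<Rightarrow> real) \<Rightarrow> ('v \<Rightarrow> real \<Rightarrow> real \<Rightarrow> real) \<Rightarrow> ('v \<Rightarrow> real \<Rightarrow> real \<Rightarrow> real) \<Rightarrow>
     ('v, 'a) traffic_state \<times> ('v \<Rightarrow> real) \<Rightarrow> bool" where
  "system_optimum G Orig Dest Demand T \<alpha> \<beta> \<gamma> t A B =
     is_arg_min (total_social_cost G Orig Dest \<alpha> \<beta> \<gamma> t A B)
       (\<lambda>z. z \<in> K1 G Orig Dest Demand \<times> K2 Dest T)"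

definition road_price :: "('a \<Rightarrow> real \<Rightarrow> real) \<Rightarrow> ('a \<Rightarrow> real) \<Rightarrow> 'a \<Rightarrow> real" where
  "road_price t x a = x a * deriv_nonneg (t a) (x a)"

definition entry_charge ::
    "('v \<Rightarrow> real \<Rightarrow> real \<Rightarrow> real) \<Rightarrow> ('v \<Rightarrow> real \<Rightarrow> real \<Rightarrow> real) \<Rightarrow>
     ('v \<Rightarrow> real) \<Rightarrow> ('v \<Rightarrow> real) \<Rightarrow> 'v \<Rightarrow> real" where
  "entry_charge A B d h s =
     - (d s * deriv_nonneg (\<lambda>y. A s y (h s)) (d s) + h s * deriv_nonneg (\<lambda>y. B s y (h s)) (d s))"

definition company_charge ::
    "('v \<Rightarrow> real \<Rightarrow> real \<Rightarrow> real) \<Rightarrow> ('v \<Rightarrow> real \<Rightarrow> real \<Rightarrow> real) \<Rightarrow>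
     ('v \<Rightarrow> real) \<Rightarrow> ('v \<Rightarrow> real) \<Rightarrow> 'v \<Rightarrow> real" where
  "company_charge A B d h s =
     - (d s * deriv_nonneg (A s (d s)) (h s) + h s * deriv_nonneg (B s (d s)) (h s))"

end

theory Submission
  imports Defs "HOL-Real_Asymp.Real_Asymp"
begin

text \<open>
  The total social cost is a sum of entropy terms \<open>c * (y * (ln y - 1))\<close> with \<open>c \<ge> 0\<close> (this is
  where \<open>\<gamma> \<le> \<alpha>\<close> enters) and a smooth part. It is continuous on the feasible set, and all its
  values there are attained on a compact set of path and business flows, so a global optimum
  exists (\<open>optimum_exists\<close>).

  At an optimum all path flows, origin-destination demands and business flows are positive.
  Otherwise one moves along the segment towards a feasible point whose path and business flows
  are all positive: each vanishing coordinate that becomes positive contributes a term of order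
  \<open>\<epsilon> * ln \<epsilon>\<close> to the change of the cost, and everything else increases it by at most a multiple
  of \<open>\<epsilon>\<close> (\<open>entropy_minimum_positive\<close>). Thus the optimum may be perturbed by shifting flow
  between any two routes from one origin, or between two business centers.

  Since \<open>ln\<close> is the derivative of the entropy, the derivative of the social cost with respect to
  a path flow \<open>f r s k\<close> is \<open>ln (f r s k) / \<alpha> + (1 / \<gamma> - 1 / \<alpha>) * ln (q r s)\<close> plus the marginal
  social cost of the trip. That marginal cost is the private cost together with the effect on
  the costs of all users of the links and of the center, and the charges are exactly these
  external effects; so it is the generalized cost in the system with charges
  (\<open>optimum_marginal_costs\<close>). Stationarity makes the derivatives equal over all routes from a
  given origin, which after exponentiation gives the nested logit formulas; the same argument
  applies to the business flows (\<open>optimum_is_equilibrium\<close>).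
\<close>

section \<open>Entropy on a segment\<close>

text \<open>The function \<open>y * (ln y - 1)\<close> is convex with derivative \<open>ln\<close>; the inequality is
  \<open>ln u \<le> u - 1\<close> at \<open>u = m / y\<close>. The point of tangency must be positive, but \<open>y = 0\<close> is
  included.\<close>

lemma entropy_above_tangent:
  fixes m y :: real
  assumes "0 < m" "0 \<le> y"
  shows "m * (ln m - 1) + (y - m) * ln m \<le> y * (ln y - 1)"
proof (cases "y = 0")
  case False
  then have "0 < y"
    using assms by simp
  then have "y * ln (m / y) \<le> y * (m / y - 1)"
    using assms by (intro mult_left_mono ln_le_minus_one) auto
  moreover have "y * (m / y - 1) = m - y"
    using \<open>0 < y\<close> by (simp add: field_simps)
  moreover have "ln (m / y) = ln m - ln y"
    using assms \<open>0 < y\<close> by (simp add: ln_div)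
  ultimately show ?thesis
    by (simp add: algebra_simps)
qed (use assms in \<open>simp add: algebra_simps\<close>)

text \<open>The average of the two tangent inequalities at \<open>m\<close>. Segments with an endpoint at \<open>0\<close>,
  where the entropy has no finite derivative, have to be covered.\<close>

lemma entropy_convex:
  fixes a b \<epsilon> :: real
  assumes "0 \<le> a" "0 \<le> b" "0 \<le> \<epsilon>" "\<epsilon> \<le> 1"
  defines "m \<equiv> (1 - \<epsilon>) * a + \<epsilon> * b"
  shows "m * (ln m - 1) \<le> a * (ln a - 1) + \<epsilon> * (b * (ln b - 1) - a * (ln a - 1))"
proof -
  have "0 \<le> m"
    using assms by simp
  consider "0 < m" | "m = 0" using \<open>0 \<le> m\<close> by linarith
  then show ?thesis
  proof cases
    case 1
    have "(1 - \<epsilon>) * (m * (ln m - 1) + (a - m) * ln m) + \<epsilon> * (m * (ln m - 1) + (b - m) * ln m)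
        \<le> (1 - \<epsilon>) * (a * (ln a - 1)) + \<epsilon> * (b * (ln b - 1))"
      using assms 1 by (intro add_mono mult_left_mono entropy_above_tangent) auto
    moreover have "(1 - \<epsilon>) * (m * (ln m - 1) + (a - m) * ln m) + \<epsilon> * (m * (ln m - 1) + (b - m) * ln m)
       = m * (ln m - 1) + (((1 - \<epsilon>) * a + \<epsilon> * b) - m) * ln m"
      by (simp add: algebra_simps)
    ultimately show ?thesis
      by (simp add: m_def algebra_simps)
  next
    case 2
    then have "(1 - \<epsilon>) * a = 0" "\<epsilon> * b = 0"
      using assms by (smt (verit) mult_nonneg_nonneg)+
    then show ?thesis
      using 2 by (auto simp: algebra_simps)
  qed
qed

lemma continuous_on_entropy: "continuous_on {0..} (\<lambda>y::real. y * (ln y - 1))"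
proof -
  have "((\<lambda>y::real. y * (ln y - 1)) \<longlongrightarrow> z * (ln z - 1)) (at z within {0..})" if "0 \<le> z" for z
  proof (cases "z = 0")
    case True
    have "((\<lambda>y::real. y * (ln y - 1)) \<longlongrightarrow> 0) (at_right 0)"
      by real_asymp
    moreover have "at (0::real) within {0..} = at_right 0"
      using at_within_Icc_at_right by (intro at_within_nhd[of _ UNIV]) auto
    ultimately show ?thesis
      using True by simp
  next
    case False
    then show ?thesis
      using that by (auto intro!: tendsto_eq_intros)
  qed
  then show ?thesis
    by (auto simp: continuous_on_def)
qed

lemma minimal_at_left_endpoint:
  fixes F :: "real \<Rightarrow> real"
  assumes D: "(F has_real_derivative D) (at 0 within {0..1})"
    and min: "\<And>\<epsilon>. 0 < \<epsilon> \<Longrightarrow> \<epsilon> \<le> 1 \<Longrightarrow> F 0 \<le> F \<epsilon>"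
  shows "0 \<le> D"
proof -
  have "((\<lambda>y. (F y - F 0) / (y - 0)) \<longlongrightarrow> D) (at 0 within {0..1})"
    using D by (simp add: has_field_derivative_iff)
  moreover have "\<forall>\<^sub>F y in at 0 within {0..1}. 0 \<le> (F y - F 0) / (y - 0)"
    using min by (auto simp: eventually_at_filter intro!: always_eventually)
  moreover have "at (0::real) within {0..1} \<noteq> bot"
    by (simp add: at_within_Icc_at_right)
  ultimately show ?thesis
    by (rule tendsto_lowerbound)
qed

text \<open>The one-dimensional core of the first-order conditions: a nonnegative combination of
  entropies plus a differentiable function is minimized, along the segment from \<open>a\<close> to \<open>b\<close>, at
  its starting point. If \<open>a i = 0 < b i\<close>, the entropy of coordinate \<open>i\<close> has slope \<open>-\<infinity>\<close> at the
  start, while convexity bounds the difference quotients of all the other entropies from above;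
  this contradicts minimality. If \<open>a\<close> is positive, everything is differentiable and the
  derivative must be nonnegative.\<close>

lemma entropy_minimum_on_segment:
  fixes c a b :: "'i \<Rightarrow> real" and S :: "real \<Rightarrow> real"
  defines "m \<equiv> \<lambda>\<epsilon> i. (1 - \<epsilon>) * a i + \<epsilon> * b i"
  assumes "finite N"
    and c: "\<And>i. i \<in> N \<Longrightarrow> 0 \<le> c i"
    and a: "\<And>i. i \<in> N \<Longrightarrow> 0 \<le> a i"
    and b: "\<And>i. i \<in> N \<Longrightarrow> 0 \<le> b i"
    and S: "(S has_real_derivative D) (at 0 within {0..1})"
    and min: "\<And>\<epsilon>. 0 < \<epsilon> \<Longrightarrow> \<epsilon> \<le> 1 \<Longrightarrow>
      (\<Sum>i\<in>N. c i * (a i * (ln (a i) - 1))) + S 0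
      \<le> (\<Sum>i\<in>N. c i * (m \<epsilon> i * (ln (m \<epsilon> i) - 1))) + S \<epsilon>"
  shows entropy_minimum_positive: "\<And>i. i \<in> N \<Longrightarrow> 0 < c i \<Longrightarrow> 0 < b i \<Longrightarrow> 0 < a i"
    and entropy_minimum_variation: "(\<And>i. i \<in> N \<Longrightarrow> 0 < a i) \<Longrightarrow>
      0 \<le> (\<Sum>i\<in>N. c i * ((b i - a i) * ln (a i))) + D"
proof -
  show "0 < a i" if i: "i \<in> N" and "0 < c i" "0 < b i" for i
  proof (rule ccontr)
    assume "\<not> 0 < a i"
    then have "a i = 0"
      using a[OF i] by simp
    define K where "K = (\<Sum>j\<in>N - {i}. c j * (b j * (ln (b j) - 1) - a j * (ln (a j) - 1)))"
    let ?L = "\<lambda>\<epsilon>. c i * b i * (ln \<epsilon> + ln (b i) - 1) + K"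
    have bound: "0 \<le> ?L \<epsilon> + (S \<epsilon> - S 0) / \<epsilon>" if \<epsilon>: "0 < \<epsilon>" "\<epsilon> \<le> 1" for \<epsilon>
    proof -
      have "(\<Sum>j\<in>N - {i}. c j * (m \<epsilon> j * (ln (m \<epsilon> j) - 1)))
          \<le> (\<Sum>j\<in>N - {i}. c j * (a j * (ln (a j) - 1)
                + \<epsilon> * (b j * (ln (b j) - 1) - a j * (ln (a j) - 1))))"
        using \<epsilon> a b c unfolding m_def
        by (intro sum_mono mult_left_mono entropy_convex) auto
      also have "\<dots> = (\<Sum>j\<in>N - {i}. c j * (a j * (ln (a j) - 1))) + \<epsilon> * K"
        unfolding K_def sum_distrib_left by (simp flip: sum.distrib add: algebra_simps)
      finally have 1: "(\<Sum>j\<in>N - {i}. c j * (m \<epsilon> j * (ln (m \<epsilon> j) - 1)))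
          \<le> (\<Sum>j\<in>N - {i}. c j * (a j * (ln (a j) - 1))) + \<epsilon> * K" .
      have 2: "c i * (m \<epsilon> i * (ln (m \<epsilon> i) - 1)) = \<epsilon> * (c i * b i * (ln \<epsilon> + ln (b i) - 1))"
        using \<epsilon> \<open>0 < b i\<close> \<open>a i = 0\<close> by (simp add: m_def ln_mult)
      have "S 0 \<le> \<epsilon> * ?L \<epsilon> + S \<epsilon>"
        using min[OF \<epsilon>] 1 2 \<open>a i = 0\<close>
        by (simp add: sum.remove[OF \<open>finite N\<close> i] distrib_left)
      then have "0 \<le> (\<epsilon> * ?L \<epsilon> + (S \<epsilon> - S 0)) / \<epsilon>"
        using \<epsilon> by (intro divide_nonneg_pos) linarith+
      then show ?thesis
        using \<epsilon> by (simp add: add_divide_distrib)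
    qed
    \<comment> \<open>As \<open>\<epsilon>\<close> decreases to \<open>0\<close>, \<open>ln \<epsilon>\<close> drives the lower bound to \<open>-\<infinity>\<close>.\<close>
    have "((\<lambda>\<epsilon>. (S \<epsilon> - S 0) / (\<epsilon> - 0)) \<longlongrightarrow> D) (at_right 0)"
      using S by (simp add: has_field_derivative_iff at_within_Icc_at_right)
    then have "\<forall>\<^sub>F \<epsilon> in at_right 0. (S \<epsilon> - S 0) / (\<epsilon> - 0) < D + 1"
      by (rule order_tendstoD) simp
    moreover have "filterlim (\<lambda>\<epsilon>::real. ?L \<epsilon>) at_bot (at_right 0)"
      using \<open>0 < c i\<close> \<open>0 < b i\<close>
      by real_asymp
    then have "\<forall>\<^sub>F \<epsilon> in at_right 0. ?L \<epsilon> < - (D + 1)"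
      by (simp add: filterlim_at_bot_dense)
    moreover have "\<forall>\<^sub>F \<epsilon> in at_right 0. (\<epsilon>::real) \<in> {0<..<1}"
      by (rule eventually_at_right_real) simp
    ultimately have "\<forall>\<^sub>F \<epsilon> in at_right (0::real). False"
    proof eventually_elim
      case (elim \<epsilon>)
      then show ?case using bound[of \<epsilon>] by simp
    qed
    then show False by simp
  qed
  assume pos: "\<And>i. i \<in> N \<Longrightarrow> 0 < a i"
  have "((\<lambda>\<epsilon>. (\<Sum>i\<in>N. c i * (m \<epsilon> i * (ln (m \<epsilon> i) - 1))) + S \<epsilon>)
      has_real_derivative (\<Sum>i\<in>N. c i * ((b i - a i) * ln (a i))) + D) (at 0 within {0..1})"
    unfolding m_def
    apply (rule DERIV_add[OF DERIV_sum S])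
    apply (rule DERIV_cmult)
    subgoal for i
      using pos[of i] by (auto intro!: derivative_eq_intros simp: field_simps)
    done
  then show "0 \<le> (\<Sum>i\<in>N. c i * ((b i - a i) * ln (a i))) + D"
    by (rule minimal_at_left_endpoint) (use min in \<open>simp add: m_def\<close>)
qed

section \<open>Multinomial logit shares\<close>

text \<open>The multiplier rule on a simplex. The only perturbation needed transfers the whole mass of
  one coordinate to another: the condition on it is linear, so no small step size has to be
  chosen.\<close>

lemma simplex_stationary:
  fixes y g :: "'j \<Rightarrow> real"
  assumes "finite J" and pos: "\<And>j. j \<in> J \<Longrightarrow> 0 < y j"
    and var: "\<And>y'. (\<And>j. j \<in> J \<Longrightarrow> 0 \<le> y' j) \<Longrightarrow> sum y' J = sum y J \<Longrightarrow>
      0 \<le> (\<Sum>j\<in>J. (y' j - y j) * g j)"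
  obtains \<mu> where "\<And>j. j \<in> J \<Longrightarrow> g j = \<mu>"
proof -
  have le: "g j \<le> g i" if "i \<in> J" "j \<in> J" for i j
  proof (cases "i = j")
    case False
    define y' where "y' = y(j := 0, i := y i + y j)"
    have rem: "sum u J = u i + (u j + sum u (J - {i} - {j}))" for u :: "'j \<Rightarrow> real"
      using that False \<open>finite J\<close> by (subst sum.remove[of _ i], simp, simp, subst sum.remove[of _ j], auto)
    have "sum y' J = sum y J"
      unfolding rem using False by (auto simp: y'_def intro!: sum.cong)
    moreover have "0 \<le> y' l" if "l \<in> J" for l
      using that \<open>i \<in> J\<close> \<open>j \<in> J\<close> pos by (auto simp: y'_def intro!: less_imp_le add_pos_pos)
    ultimately have "0 \<le> (\<Sum>l\<in>J. (y' l - y l) * g l)"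
      by (intro var)
    also have "\<dots> = y j * g i - y j * g j"
    proof -
      have "(\<Sum>l\<in>J - {i} - {j}. (y' l - y l) * g l) = 0"
        by (rule sum.neutral) (auto simp: y'_def)
      then show ?thesis
        unfolding rem using False by (simp add: y'_def)
    qed
    finally show ?thesis
      using pos[OF \<open>j \<in> J\<close>] by simp
  qed simp
  show thesis
  proof (cases "J = {}")
    case True
    then show thesis using that by blast
  next
    case False
    then obtain i where "i \<in> J" by blast
    show thesis
      by (rule that[of "g i"]) (use le \<open>i \<in> J\<close> in \<open>auto intro: antisym\<close>)
  qed
qed

lemma logit_share:
  fixes y u :: "'j \<Rightarrow> real"
  assumes "finite J" "sum y J = M" and y: "\<And>j. j \<in> J \<Longrightarrow> y j = C * exp (u j)" and i: "i \<in> J"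
  shows "y i = M * (exp (u i) / (\<Sum>j\<in>J. exp (u j)))"
proof -
  have "M = C * (\<Sum>j\<in>J. exp (u j))"
    using assms(2) y by (simp add: sum_distrib_left)
  moreover have "0 < (\<Sum>j\<in>J. exp (u j))"
    using \<open>finite J\<close> i by (intro sum_pos) auto
  ultimately show ?thesis
    using y[OF i] by simp
qed

section \<open>Calculus on the nonnegative quadrant\<close>

lemma continuously_differentiable_on_imp_continuous_on:
  "continuously_differentiable_on S f \<Longrightarrow> continuous_on S f"
proof -
  assume "continuously_differentiable_on S f"
  then obtain f' where "\<And>p. p \<in> S \<Longrightarrow> (f has_derivative blinfun_apply (f' p)) (at p within S)"
    unfolding continuously_differentiable_on_def by blast
  then show ?thesis
    by (rule has_derivative_continuous_on)
qed

text \<open>At \<open>x = 0\<close> the derivative is one-sided; it is still unique because every point of \<open>{0..}\<close>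
  is a limit point of \<open>{0..}\<close>.\<close>

lemma deriv_nonneg_eq:
  assumes "(f has_real_derivative D) (at x within {0..})" "0 \<le> x"
  shows "deriv_nonneg f x = D"
proof -
  have "at x within {0..} \<noteq> bot"
  proof -
    have "{x<..} \<subseteq> {0..}" using assms by auto
    then have "at_right x \<le> at x within {0..}" by (rule at_le)
    then show ?thesis by (metis bot.extremum_uniqueI trivial_limit_at_right_real)
  qed
  then show ?thesis
    unfolding deriv_nonneg_def
    using assms by (intro vector_derivative_within) (auto simp: has_real_derivative_iff_has_vector_derivative)
qed

lemma DERIV_deriv_nonneg:
  assumes "continuously_differentiable_on {0..} f" "0 \<le> x"
  shows "(f has_real_derivative deriv_nonneg f x) (at x within {0..})"
proof -
  obtain f' where "(f has_derivative f') (at x within {0..})"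
    using assms unfolding continuously_differentiable_on_def by fastforce
  then obtain D where "(f has_real_derivative D) (at x within {0..})"
    using has_real_derivative by blast
  then show ?thesis
    using deriv_nonneg_eq[OF _ assms(2)] by simp
qed

text \<open>Also on the boundary of the quadrant the total derivative is determined by the two
  one-sided partial derivatives, since the coordinate half-lines through a point stay inside the
  quadrant. The charges are defined by these partial derivatives.\<close>

lemma has_derivative_partials:
  assumes "continuously_differentiable_on ({0..} \<times> {0..}) (\<lambda>(y, z). F y z)" "0 \<le> y" "0 \<le> z"
  shows "((\<lambda>(y, z). F y z) has_derivative
      (\<lambda>(u, v). u * deriv_nonneg (\<lambda>y. F y z) y + v * deriv_nonneg (F y) z))
      (at (y, z) within {0..} \<times> {0..})"
proof -
  obtain F' where F': "((\<lambda>(y, z). F y z) has_derivative F') (at (y, z) within {0..} \<times> {0..})"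
    using assms unfolding continuously_differentiable_on_def by fastforce
  then have lin: "linear F'"
    by (rule has_derivative_linear)
  have "((\<lambda>y. F y z) has_derivative (\<lambda>u. F' (u, 0))) (at y within {0..})"
  proof -
    have i: "((\<lambda>y. (y, z)) has_derivative (\<lambda>u. (u, 0))) (at y within {0..})"
      by (auto intro!: derivative_eq_intros)
    have o: "((\<lambda>(y, z). F y z) has_derivative F') (at (y, z) within (\<lambda>y. (y, z)) ` {0..})"
      using assms by (intro has_derivative_subset[OF F']) auto
    show ?thesis
      using has_derivative_in_compose[OF i o] by simp
  qed
  moreover have "(\<lambda>u. F' (u, 0)) = (*) (F' (1, 0))"
  proof
    show "F' (u, 0) = F' (1, 0) * u" for u
      using linear_scale[OF lin, of u "(1, 0)"] by simp
  qed
  ultimately have 1: "deriv_nonneg (\<lambda>y. F y z) y = F' (1, 0)"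
    using assms by (intro deriv_nonneg_eq) (simp_all add: has_field_derivative_def)
  have "(F y has_derivative (\<lambda>v. F' (0, v))) (at z within {0..})"
  proof -
    have i: "((\<lambda>z. (y, z)) has_derivative (\<lambda>v. (0, v))) (at z within {0..})"
      by (auto intro!: derivative_eq_intros)
    have o: "((\<lambda>(y, z). F y z) has_derivative F') (at (y, z) within (\<lambda>z. (y, z)) ` {0..})"
      using assms by (intro has_derivative_subset[OF F']) auto
    show ?thesis
      using has_derivative_in_compose[OF i o] by simp
  qed
  moreover have "(\<lambda>v. F' (0, v)) = (*) (F' (0, 1))"
  proof
    show "F' (0, v) = F' (0, 1) * v" for v
      using linear_scale[OF lin, of v "(0, 1)"] by simp
  qed
  ultimately have 2: "deriv_nonneg (F y) z = F' (0, 1)"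
    using assms by (intro deriv_nonneg_eq) (simp_all add: has_field_derivative_def)
  have "F' p = fst p * F' (1, 0) + snd p * F' (0, 1)" for p
  proof -
    have "F' p = F' (fst p *\<^sub>R (1, 0) + snd p *\<^sub>R (0, 1))"
      by simp
    also have "\<dots> = fst p * F' (1, 0) + snd p * F' (0, 1)"
      unfolding linear_add[OF lin] linear_scale[OF lin] by simp
    finally show ?thesis .
  qed
  then have "F' = (\<lambda>(u, v). u * deriv_nonneg (\<lambda>y. F y z) y + v * deriv_nonneg (F y) z)"
    unfolding 1 2 case_prod_beta' by (rule ext)
  then show ?thesis
    using F' by (simp only:)
qed

lemma DERIV_along_segment:
  assumes "continuously_differentiable_on {0..} f" "0 \<le> x" "0 \<le> x'"
  shows "((\<lambda>\<epsilon>. f ((1 - \<epsilon>) * x + \<epsilon> * x')) has_real_derivative (x' - x) * deriv_nonneg f x)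
    (at 0 within {0..1})"
proof -
  let ?g = "\<lambda>\<epsilon>. (1 - \<epsilon>) * x + \<epsilon> * x'"
  have "?g ` {0..1} \<subseteq> {0..}"
    using assms by auto
  then have "(f has_real_derivative deriv_nonneg f x) (at (?g 0) within ?g ` {0..1})"
    using DERIV_deriv_nonneg[OF assms(1,2)] by (auto intro: has_field_derivative_subset)
  moreover have "(?g has_real_derivative x' - x) (at 0 within {0..1})"
    by (auto intro!: derivative_eq_intros)
  ultimately show ?thesis
    using DERIV_image_chain by (force simp: o_def mult.commute)
qed

lemma DERIV_along_segment2:
  assumes "continuously_differentiable_on ({0..} \<times> {0..}) (\<lambda>(y, z). F y z)"
    and "0 \<le> y" "0 \<le> y'" "0 \<le> z" "0 \<le> z'"
  shows "((\<lambda>\<epsilon>. F ((1 - \<epsilon>) * y + \<epsilon> * y') ((1 - \<epsilon>) * z + \<epsilon> * z')) has_real_derivative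
      (y' - y) * deriv_nonneg (\<lambda>y. F y z) y + (z' - z) * deriv_nonneg (F y) z) (at 0 within {0..1})"
proof -
  let ?g = "\<lambda>\<epsilon>. ((1 - \<epsilon>) * y + \<epsilon> * y', (1 - \<epsilon>) * z + \<epsilon> * z')"
  have "?g ` {0..1} \<subseteq> {0..} \<times> {0..}"
    using assms by auto
  then have o: "((\<lambda>(y, z). F y z) has_derivative
      (\<lambda>(u, v). u * deriv_nonneg (\<lambda>y. F y z) y + v * deriv_nonneg (F y) z)) (at (?g 0) within ?g ` {0..1})"
    using has_derivative_partials[OF assms(1,2,4)] by (auto intro: has_derivative_subset)
  have g: "(?g has_derivative (\<lambda>\<epsilon>. (\<epsilon> * (y' - y), \<epsilon> * (z' - z)))) (at 0 within {0..1})"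
    by (auto intro!: derivative_eq_intros simp: algebra_simps)
  have "(\<lambda>\<epsilon>. case (\<epsilon> * (y' - y), \<epsilon> * (z' - z)) of
      (u, v) \<Rightarrow> u * deriv_nonneg (\<lambda>y. F y z) y + v * deriv_nonneg (F y) z)
    = (*) ((y' - y) * deriv_nonneg (\<lambda>y. F y z) y + (z' - z) * deriv_nonneg (F y) z)"
    by (auto simp: fun_eq_iff algebra_simps)
  then show ?thesis
    using has_derivative_in_compose[OF g o] unfolding has_field_derivative_def by simp
qed

section \<open>Compactness of boxes in function spaces\<close>

text \<open>Tychonoff's theorem for the topology of pointwise convergence.\<close>

lemma compact_function_box:
  fixes C :: "'i \<Rightarrow> 'b::topological_space set"
  assumes "\<And>i. compact (C i)"
  shows "compact {f. \<forall>i. f i \<in> C i}"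
proof -
  have "compactin (product_topology (\<lambda>_. euclidean) UNIV) (PiE UNIV C)"
    using assms by (simp add: compactin_PiE)
  moreover have "PiE UNIV C = {f. \<forall>i. f i \<in> C i}"
    by auto
  ultimately show ?thesis
    by (simp add: euclidean_product_topology)
qed

section \<open>The network and its feasible set\<close>

locale logit_network = fin_digraph G
  for G :: "('v, 'a) pre_digraph" +
  fixes Orig Dest :: "'v set"
    and Demand :: "'v \<Rightarrow> real"
    and T \<alpha> \<beta> \<gamma> :: real
    and t :: "'a \<Rightarrow> real \<Rightarrow> real"
    and A B :: "'v \<Rightarrow> real \<Rightarrow> real \<Rightarrow> real"
  assumes Orig: "Orig \<subseteq> verts G" "Orig \<noteq> {}"
    and Dest: "Dest \<subseteq> verts G" "Dest \<noteq> {}"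
    and routes_nonempty: "\<And>r s. r \<in> Orig \<Longrightarrow> s \<in> Dest \<Longrightarrow> routes G r s \<noteq> {}"
    and Demand_pos: "\<And>r. r \<in> Orig \<Longrightarrow> 0 < Demand r"
    and T_pos: "0 < T"
    and \<alpha>_pos: "0 < \<alpha>" and \<beta>_pos: "0 < \<beta>" and \<gamma>_pos: "0 < \<gamma>" and \<gamma>_le_\<alpha>: "\<gamma> \<le> \<alpha>"
    and t_diff: "\<And>a. a \<in> arcs G \<Longrightarrow> continuously_differentiable_on {0..} (t a)"
    and A_diff: "\<And>s. s \<in> Dest \<Longrightarrow>
      continuously_differentiable_on ({0..} \<times> {0..}) (\<lambda>(y, z). A s y z)"
    and B_diff: "\<And>s. s \<in> Dest \<Longrightarrow>
      continuously_differentiable_on ({0..} \<times> {0..}) (\<lambda>(y, z). B s y z)"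
begin

lemma finite_Orig: "finite Orig" and finite_Dest: "finite Dest"
  using Orig Dest finite_verts finite_subset by blast+

lemma finite_routes: "finite (routes G r s)"
  unfolding routes_def by (rule apaths_finite)

abbreviation feasible :: "(('v, 'a) traffic_state \<times> ('v \<Rightarrow> real)) set" where
  "feasible \<equiv> K1 G Orig Dest Demand \<times> K2 Dest T"

abbreviation cost :: "('v, 'a) traffic_state \<times> ('v \<Rightarrow> real) \<Rightarrow> real" where
  "cost \<equiv> total_social_cost G Orig Dest \<alpha> \<beta> \<gamma> t A B"

abbreviation optimum :: "('v, 'a) traffic_state \<times> ('v \<Rightarrow> real) \<Rightarrow> bool" where
  "optimum \<equiv> system_optimum G Orig Dest Demand T \<alpha> \<beta> \<gamma> t A B"

lemma optimum_iff: "optimum z \<longleftrightarrow> z \<in> feasible \<and> (\<forall>w\<in>feasible. cost z \<le> cost w)"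
  unfolding system_optimum_def is_arg_min_linorder by blast

lemma K1_D:
  assumes "(f, x, q, d) \<in> K1 G Orig Dest Demand"
  shows flow_nonneg: "r \<in> Orig \<Longrightarrow> s \<in> Dest \<Longrightarrow> k \<in> routes G r s \<Longrightarrow> 0 \<le> f r s k"
    and flow_sum: "r \<in> Orig \<Longrightarrow> s \<in> Dest \<Longrightarrow> (\<Sum>k\<in>routes G r s. f r s k) = q r s"
    and od_sum: "r \<in> Orig \<Longrightarrow> (\<Sum>s\<in>Dest. q r s) = Demand r"
    and link_sum: "a \<in> arcs G \<Longrightarrow>
      (\<Sum>r\<in>Orig. \<Sum>s\<in>Dest. \<Sum>k\<in>routes G r s. incidence a k * f r s k) = x a"
    and dest_sum: "s \<in> Dest \<Longrightarrow> (\<Sum>r\<in>Orig. q r s) = d s"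
  using assms unfolding K1_def by auto

lemma K1_nonneg:
  assumes z: "(f, x, q, d) \<in> K1 G Orig Dest Demand"
  shows od_nonneg: "r \<in> Orig \<Longrightarrow> s \<in> Dest \<Longrightarrow> 0 \<le> q r s"
    and link_nonneg: "a \<in> arcs G \<Longrightarrow> 0 \<le> x a"
    and dest_nonneg: "s \<in> Dest \<Longrightarrow> 0 \<le> d s"
proof -
  show q: "0 \<le> q r s" if "r \<in> Orig" "s \<in> Dest" for r s
    unfolding flow_sum[OF z that, symmetric] using flow_nonneg[OF z that] by (rule sum_nonneg)
  show "0 \<le> x a" if "a \<in> arcs G"
    unfolding link_sum[OF z that, symmetric]
    by (intro sum_nonneg mult_nonneg_nonneg flow_nonneg[OF z]) (auto simp: incidence_def)
  show "0 \<le> d s" if "s \<in> Dest"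
    unfolding dest_sum[OF z that, symmetric] using q that by (intro sum_nonneg)
qed

lemma K2_D:
  assumes "h \<in> K2 Dest T"
  shows business_nonneg: "s \<in> Dest \<Longrightarrow> 0 \<le> h s" and business_sum: "sum h Dest = T"
  using assms unfolding K2_def by auto

text \<open>Path flows determine all other traffic variables, so a feasible point may be specified by
  its path and business flows alone.\<close>

definition path_traffic :: "('v \<Rightarrow> 'v \<Rightarrow> 'a awalk \<Rightarrow> real) \<Rightarrow> ('v, 'a) traffic_state" where
  "path_traffic f = (f,
     \<lambda>a. \<Sum>r\<in>Orig. \<Sum>s\<in>Dest. \<Sum>k\<in>routes G r s. incidence a k * f r s k,
     \<lambda>r s. \<Sum>k\<in>routes G r s. f r s k,
     \<lambda>s. \<Sum>r\<in>Orig. \<Sum>k\<in>routes G r s. f r s k)"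

lemma path_traffic_in_K1:
  assumes "\<And>r s k. r \<in> Orig \<Longrightarrow> s \<in> Dest \<Longrightarrow> k \<in> routes G r s \<Longrightarrow> 0 \<le> f r s k"
    and "\<And>r. r \<in> Orig \<Longrightarrow> (\<Sum>s\<in>Dest. \<Sum>k\<in>routes G r s. f r s k) = Demand r"
  shows "path_traffic f \<in> K1 G Orig Dest Demand"
  using assms by (simp add: path_traffic_def K1_def)

text \<open>The uniform flows serve twice: they show that the feasible set is nonempty, and they are
  the positive point towards which a boundary point is perturbed.\<close>

definition uniform_flow :: "'v \<Rightarrow> 'v \<Rightarrow> 'a awalk \<Rightarrow> real" where
  "uniform_flow r s k = Demand r / (real (card Dest) * real (card (routes G r s)))"

definition uniform_business :: "'v \<Rightarrow> real" where
  "uniform_business s = T / real (card Dest)"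

lemma uniform_pos:
  shows uniform_flow_pos: "r \<in> Orig \<Longrightarrow> s \<in> Dest \<Longrightarrow> 0 < uniform_flow r s k"
    and uniform_business_pos: "0 < uniform_business s"
  using finite_Dest Dest finite_routes routes_nonempty Demand_pos T_pos
  by (auto simp: uniform_flow_def uniform_business_def card_gt_0_iff intro!: divide_pos_pos mult_pos_pos)

lemma uniform_feasible: "(path_traffic uniform_flow, uniform_business) \<in> feasible"
proof -
  have n: "real (card Dest) \<noteq> 0"
    using finite_Dest Dest by simp
  have "(\<Sum>s\<in>Dest. \<Sum>k\<in>routes G r s. uniform_flow r s k) = Demand r" if r: "r \<in> Orig" for r
  proof -
    have "(\<Sum>k\<in>routes G r s. uniform_flow r s k) = Demand r / real (card Dest)" if "s \<in> Dest" for s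
      using routes_nonempty[OF r that] finite_routes[of r s] n by (simp add: uniform_flow_def)
    then show ?thesis
      using n by simp
  qed
  moreover have "sum uniform_business Dest = T"
    using n by (simp add: uniform_business_def)
  ultimately show ?thesis
    using uniform_pos by (auto simp: K2_def less_imp_le intro!: path_traffic_in_K1)
qed

definition mix ::
    "real \<Rightarrow> ('v, 'a) traffic_state \<times> ('v \<Rightarrow> real) \<Rightarrow> ('v, 'a) traffic_state \<times> ('v \<Rightarrow> real) \<Rightarrow>
     ('v, 'a) traffic_state \<times> ('v \<Rightarrow> real)" where
  "mix \<epsilon> = (\<lambda>((f, x, q, d), h) ((f', x', q', d'), h').
     ((\<lambda>r s k. (1 - \<epsilon>) * f r s k + \<epsilon> * f' r s k,
       \<lambda>a. (1 - \<epsilon>) * x a + \<epsilon> * x' a,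
       \<lambda>r s. (1 - \<epsilon>) * q r s + \<epsilon> * q' r s,
       \<lambda>s. (1 - \<epsilon>) * d s + \<epsilon> * d' s),
      \<lambda>s. (1 - \<epsilon>) * h s + \<epsilon> * h' s))"

lemma mix_feasible:
  assumes "z \<in> feasible" "w \<in> feasible" "0 \<le> \<epsilon>" "\<epsilon> \<le> 1"
  shows "mix \<epsilon> z w \<in> feasible"
proof -
  obtain f x q d h where z: "z = ((f, x, q, d), h)" by (metis surj_pair)
  obtain f' x' q' d' h' where w: "w = ((f', x', q', d'), h')" by (metis surj_pair)
  have comm: "incidence a k * (c * y) = c * (incidence a k * y)" for a c y and k :: "'a awalk"
    by simp
  show ?thesis
    using assms unfolding z w mix_def K1_def K2_def
    by (simp add: sum.distrib distrib_left comm flip: sum_distrib_left) (simp add: algebra_simps)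
qed

section \<open>Existence of a system optimum\<close>

lemma cost_cong:
  assumes "\<And>r s k. r \<in> Orig \<Longrightarrow> s \<in> Dest \<Longrightarrow> k \<in> routes G r s \<Longrightarrow> f r s k = f' r s k"
    and "\<And>a. a \<in> arcs G \<Longrightarrow> x a = x' a"
    and "\<And>r s. r \<in> Orig \<Longrightarrow> s \<in> Dest \<Longrightarrow> q r s = q' r s"
    and "\<And>s. s \<in> Dest \<Longrightarrow> d s = d' s" "\<And>s. s \<in> Dest \<Longrightarrow> h s = h' s"
  shows "cost ((f, x, q, d), h) = cost ((f', x', q', d'), h')"
  unfolding total_social_cost_def prod.case
  by (intro arg_cong2[where f = "(+)"] arg_cong2[where f = "(-)"] arg_cong2[where f = "(*)"] sum.cong refl)
    (simp_all only: assms)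

text \<open>The components of a state outside the network are unconstrained, so the feasible set
  itself need not be compact. Bounding all components, including the irrelevant ones, gives a
  compact set of flows that still attains every feasible cost (\<open>feasible_has_balanced_flows\<close>).\<close>

definition flow_box :: "(('v \<Rightarrow> 'v \<Rightarrow> 'a awalk \<Rightarrow> real) \<times> ('v \<Rightarrow> real)) set" where
  "flow_box = {f. \<forall>r. f r \<in> {g. \<forall>s. g s \<in> {e. \<forall>k. e k \<in> {0..\<bar>Demand r\<bar>}}}} \<times> {h. \<forall>s. h s \<in> {0..T}}"

definition balanced_flows :: "(('v \<Rightarrow> 'v \<Rightarrow> 'a awalk \<Rightarrow> real) \<times> ('v \<Rightarrow> real)) set" where
  "balanced_flows = flow_box \<inter> ({p. \<forall>r\<in>Orig. (\<Sum>s\<in>Dest. \<Sum>k\<in>routes G r s. fst p r s k) = Demand r}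
     \<inter> {p. (\<Sum>s\<in>Dest. snd p s) = T})"

lemma continuous_on_flow [continuous_intros]:
  "continuous_on S (\<lambda>p :: ('v \<Rightarrow> 'v \<Rightarrow> 'a awalk \<Rightarrow> real) \<times> ('v \<Rightarrow> real). fst p r s k)"
  by (rule continuous_on_product_then_coordinatewise[OF
        continuous_on_product_then_coordinatewise[OF
          continuous_on_product_then_coordinatewise[OF continuous_on_fst[OF continuous_on_id]]]])

lemma continuous_on_business [continuous_intros]:
  "continuous_on S (\<lambda>p :: ('v \<Rightarrow> 'v \<Rightarrow> 'a awalk \<Rightarrow> real) \<times> ('v \<Rightarrow> real). snd p s)"
  by (rule continuous_on_product_then_coordinatewise[OF continuous_on_snd[OF continuous_on_id]])

lemma compact_balanced_flows: "compact balanced_flows"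
proof -
  have "{p :: ('v \<Rightarrow> 'v \<Rightarrow> 'a awalk \<Rightarrow> real) \<times> ('v \<Rightarrow> real).
        \<forall>r\<in>Orig. (\<Sum>s\<in>Dest. \<Sum>k\<in>routes G r s. fst p r s k) = Demand r}
      = (\<Inter>r\<in>Orig. {p. (\<Sum>s\<in>Dest. \<Sum>k\<in>routes G r s. fst p r s k) = Demand r})"
    by auto
  then have "closed {p :: ('v \<Rightarrow> 'v \<Rightarrow> 'a awalk \<Rightarrow> real) \<times> ('v \<Rightarrow> real).
      \<forall>r\<in>Orig. (\<Sum>s\<in>Dest. \<Sum>k\<in>routes G r s. fst p r s k) = Demand r}"
    by (auto intro!: closed_INT closed_Collect_eq continuous_intros)
  moreover have "closed {p :: ('v \<Rightarrow> 'v \<Rightarrow> 'a awalk \<Rightarrow> real) \<times> ('v \<Rightarrow> real).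
      (\<Sum>s\<in>Dest. snd p s) = T}"
    by (intro closed_Collect_eq continuous_intros)
  moreover have "compact flow_box"
    unfolding flow_box_def by (intro compact_Times compact_function_box compact_Icc)
  ultimately show ?thesis
    unfolding balanced_flows_def by (intro compact_Int_closed closed_Int)
qed

lemma balanced_flows_feasible:
  assumes "(f, h) \<in> balanced_flows"
  shows "(path_traffic f, h) \<in> feasible"
  using assms unfolding balanced_flows_def flow_box_def
  by (auto simp: K2_def intro!: path_traffic_in_K1)

lemma feasible_has_balanced_flows:
  assumes "((f, x, q, d), h) \<in> feasible"
  obtains f' h' where "(f', h') \<in> balanced_flows"
    and "cost (path_traffic f', h') = cost ((f, x, q, d), h)"
proof -
  have K: "(f, x, q, d) \<in> K1 G Orig Dest Demand" and K2: "h \<in> K2 Dest T"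
    using assms by auto
  define f' where "f' = (\<lambda>r s k. if r \<in> Orig \<and> s \<in> Dest \<and> k \<in> routes G r s then f r s k else 0)"
  define h' where "h' = (\<lambda>s. if s \<in> Dest then h s else 0)"
  have f': "f' r s k = f r s k" if "r \<in> Orig" "s \<in> Dest" "k \<in> routes G r s" for r s k
    using that by (simp add: f'_def)
  have h': "h' s = h s" if "s \<in> Dest" for s
    using that by (simp add: h'_def)
  have "f r s k \<le> Demand r" if "r \<in> Orig" "s \<in> Dest" "k \<in> routes G r s" for r s k
  proof -
    have "f r s k \<le> q r s"
      unfolding flow_sum[OF K that(1,2), symmetric]
      using that finite_routes by (intro member_le_sum flow_nonneg[OF K]) auto
    also have "\<dots> \<le> Demand r"
      unfolding od_sum[OF K that(1), symmetric]
      using that finite_Dest by (intro member_le_sum od_nonneg[OF K]) auto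
    finally show ?thesis .
  qed
  moreover have "h s \<le> T" if "s \<in> Dest" for s
    unfolding business_sum[OF K2, symmetric]
    using that finite_Dest by (intro member_le_sum business_nonneg[OF K2]) auto
  ultimately have "(f', h') \<in> flow_box"
    unfolding flow_box_def f'_def h'_def
    using flow_nonneg[OF K] business_nonneg[OF K2] T_pos by force
  moreover have "(\<Sum>s\<in>Dest. \<Sum>k\<in>routes G r s. f' r s k) = Demand r" if "r \<in> Orig" for r
    using that by (simp add: f' flow_sum[OF K] od_sum[OF K])
  ultimately have "(f', h') \<in> balanced_flows"
    using business_sum[OF K2] by (simp add: balanced_flows_def h')
  moreover have "cost (path_traffic f', h') = cost ((f, x, q, d), h)"
    unfolding path_traffic_def
    by (rule cost_cong) (simp_all add: f' h' flow_sum[OF K] link_sum[OF K] dest_sum[OF K])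
  ultimately show thesis
    by (rule that)
qed

lemma continuous_on_cost: "continuous_on balanced_flows (\<lambda>p. cost (path_traffic (fst p), snd p))"
proof -
  have nonneg: "0 \<le> fst p r s k" "0 \<le> snd p s" if "p \<in> balanced_flows" for p r s k
    using that unfolding balanced_flows_def flow_box_def by auto
  have entropy: "continuous_on balanced_flows (\<lambda>p. g p * (ln (g p) - 1))"
    if "continuous_on balanced_flows g" "\<And>p. p \<in> balanced_flows \<Longrightarrow> 0 \<le> g p"
    for g :: "('v \<Rightarrow> 'v \<Rightarrow> 'a awalk \<Rightarrow> real) \<times> ('v \<Rightarrow> real) \<Rightarrow> real"
    using that(2) by (intro continuous_on_compose2[OF continuous_on_entropy that(1)]) auto
  have t: "continuous_on balanced_flows (\<lambda>p. t a (g p))"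
    if "a \<in> arcs G" "continuous_on balanced_flows g" "\<And>p. p \<in> balanced_flows \<Longrightarrow> 0 \<le> g p"
    for a and g :: "('v \<Rightarrow> 'v \<Rightarrow> 'a awalk \<Rightarrow> real) \<times> ('v \<Rightarrow> real) \<Rightarrow> real"
  proof (rule continuous_on_compose2[OF _ that(2)])
    show "continuous_on {0..} (t a)"
      by (intro continuously_differentiable_on_imp_continuous_on t_diff that)
  qed (use that in auto)
  have F: "continuous_on balanced_flows (\<lambda>p. F (g p) (snd p s))"
    if "continuously_differentiable_on ({0..} \<times> {0..}) (\<lambda>(y, z). F y z)"
      and "continuous_on balanced_flows g" "\<And>p. p \<in> balanced_flows \<Longrightarrow> 0 \<le> g p"
    for F :: "real \<Rightarrow> real \<Rightarrow> real" and s
      and g :: "('v \<Rightarrow> 'v \<Rightarrow> 'a awalk \<Rightarrow> real) \<times> ('v \<Rightarrow> real) \<Rightarrow> real"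
  proof -
    have "continuous_on ({0..} \<times> {0..}) (\<lambda>(y, z). F y z)"
      by (intro continuously_differentiable_on_imp_continuous_on that)
    moreover have "continuous_on balanced_flows (\<lambda>p. (g p, snd p s))"
      by (intro continuous_intros that)
    ultimately have "continuous_on balanced_flows (\<lambda>p. case (g p, snd p s) of (y, z) \<Rightarrow> F y z)"
      by (rule continuous_on_compose2) (use that nonneg in auto)
    then show ?thesis
      by simp
  qed
  have inc: "0 \<le> incidence a k" for a and k :: "'a awalk"
    by (simp add: incidence_def)
  define X where "X p a = (\<Sum>r\<in>Orig. \<Sum>s\<in>Dest. \<Sum>k\<in>routes G r s. incidence a k * fst p r s k)"
    for p :: "('v \<Rightarrow> 'v \<Rightarrow> 'a awalk \<Rightarrow> real) \<times> ('v \<Rightarrow> real)" and a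
  define Q where "Q p r s = (\<Sum>k\<in>routes G r s. fst p r s k)"
    for p :: "('v \<Rightarrow> 'v \<Rightarrow> 'a awalk \<Rightarrow> real) \<times> ('v \<Rightarrow> real)" and r s
  define E where "E p s = (\<Sum>r\<in>Orig. Q p r s)"
    for p :: "('v \<Rightarrow> 'v \<Rightarrow> 'a awalk \<Rightarrow> real) \<times> ('v \<Rightarrow> real)" and s
  have cont: "continuous_on balanced_flows (\<lambda>p. X p a)" "continuous_on balanced_flows (\<lambda>p. Q p r s)"
    "continuous_on balanced_flows (\<lambda>p. E p s)" for a r s
    unfolding X_def E_def Q_def
    by (intro continuous_on_sum continuous_on_mult_left continuous_on_flow)+
  have pos: "0 \<le> X p a" "0 \<le> Q p r s" "0 \<le> E p s" if "p \<in> balanced_flows" for p a r s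
    unfolding X_def E_def Q_def
    by (intro sum_nonneg mult_nonneg_nonneg inc nonneg[OF that])+
  have "continuous_on balanced_flows (\<lambda>p. X p a * t a (X p a))" if "a \<in> arcs G" for a
    by (intro continuous_on_mult t cont pos that)
  moreover have "continuous_on balanced_flows (\<lambda>p. A s (E p s) (snd p s) * E p s)" if "s \<in> Dest" for s
    by (intro continuous_on_mult F[OF A_diff] cont pos that)
  moreover have "continuous_on balanced_flows (\<lambda>p. B s (E p s) (snd p s) * snd p s)" if "s \<in> Dest" for s
    by (intro continuous_on_mult F[OF B_diff] cont pos that continuous_on_business)
  moreover have "continuous_on balanced_flows (\<lambda>p. fst p r s k * (ln (fst p r s k) - 1))" for r s k
    by (intro entropy continuous_on_flow nonneg)
  moreover have "continuous_on balanced_flows (\<lambda>p. Q p r s * (ln (Q p r s) - 1))" for r s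
    by (intro entropy cont pos)
  moreover have "continuous_on balanced_flows (\<lambda>p. snd p s * (ln (snd p s) - 1))" for s
    by (intro entropy continuous_on_business nonneg)
  ultimately show ?thesis
    unfolding total_social_cost_def path_traffic_def prod.case
      X_def[symmetric] Q_def[symmetric] E_def[symmetric]
    by (intro continuous_on_add continuous_on_diff continuous_on_mult_left continuous_on_sum)
qed

lemma optimum_exists: "\<exists>z. optimum z"
proof -
  have "balanced_flows \<noteq> {}"
    using uniform_feasible feasible_has_balanced_flows unfolding path_traffic_def by blast
  then obtain p where p: "p \<in> balanced_flows"
    and min: "\<And>p'. p' \<in> balanced_flows \<Longrightarrow>
      cost (path_traffic (fst p), snd p) \<le> cost (path_traffic (fst p'), snd p')"
    using continuous_attains_inf[OF compact_balanced_flows _ continuous_on_cost] by blast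
  have "cost (path_traffic (fst p), snd p) \<le> cost w" if "w \<in> feasible" for w
  proof -
    obtain f x q d h where w: "w = ((f, x, q, d), h)" by (metis surj_pair)
    obtain f' h' where "(f', h') \<in> balanced_flows" "cost (path_traffic f', h') = cost w"
      using feasible_has_balanced_flows \<open>w \<in> feasible\<close> unfolding w by blast
    then show ?thesis
      using min[of "(f', h')"] by simp
  qed
  moreover have "(path_traffic (fst p), snd p) \<in> feasible"
    using balanced_flows_feasible[of "fst p" "snd p"] p by simp
  ultimately show ?thesis
    unfolding optimum_iff by blast
qed

section \<open>First-order conditions at a system optimum\<close>

definition smooth_cost :: "('a \<Rightarrow> real) \<Rightarrow> ('v \<Rightarrow> real) \<Rightarrow> ('v \<Rightarrow> real) \<Rightarrow> real" where
  "smooth_cost x d h = (\<Sum>a\<in>arcs G. x a * t a (x a))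
     - (\<Sum>s\<in>Dest. A s (d s) (h s) * d s) - (\<Sum>s\<in>Dest. B s (d s) (h s) * h s)"

definition charged_time :: "('a \<Rightarrow> real) \<Rightarrow> 'a \<Rightarrow> real \<Rightarrow> real" where
  "charged_time x = (\<lambda>a y. t a y + road_price t x a)"

definition charged_trip :: "('v \<Rightarrow> real) \<Rightarrow> ('v \<Rightarrow> real) \<Rightarrow> 'v \<Rightarrow> real \<Rightarrow> real \<Rightarrow> real" where
  "charged_trip d h = (\<lambda>s y z. A s y z - entry_charge A B d h s)"

definition charged_business :: "('v \<Rightarrow> real) \<Rightarrow> ('v \<Rightarrow> real) \<Rightarrow> 'v \<Rightarrow> real \<Rightarrow> real \<Rightarrow> real" where
  "charged_business d h = (\<lambda>s y z. B s y z - company_charge A B d h s)"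

text \<open>This identity is the reason for the charges. By the product rule, \<open>x * t a x\<close> has
  derivative \<open>t a x + x * deriv_nonneg (t a) x\<close>, whose second summand is the road price;
  likewise, the derivatives of \<open>A s d h * d + B s d h * h\<close> with respect to \<open>d\<close> and \<open>h\<close> are
  \<open>A s d h\<close> and \<open>B s d h\<close> minus the charges on travelers and on companies, respectively.\<close>

lemma DERIV_smooth_cost:
  assumes "\<And>a. a \<in> arcs G \<Longrightarrow> 0 \<le> x a" "\<And>a. a \<in> arcs G \<Longrightarrow> 0 \<le> x' a"
    and "\<And>s. s \<in> Dest \<Longrightarrow> 0 \<le> d s" "\<And>s. s \<in> Dest \<Longrightarrow> 0 \<le> d' s"
    and "\<And>s. s \<in> Dest \<Longrightarrow> 0 \<le> h s" "\<And>s. s \<in> Dest \<Longrightarrow> 0 \<le> h' s"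
  shows "((\<lambda>\<epsilon>. smooth_cost (\<lambda>a. (1 - \<epsilon>) * x a + \<epsilon> * x' a) (\<lambda>s. (1 - \<epsilon>) * d s + \<epsilon> * d' s)
        (\<lambda>s. (1 - \<epsilon>) * h s + \<epsilon> * h' s)) has_real_derivative
      (\<Sum>a\<in>arcs G. (x' a - x a) * charged_time x a (x a))
      - (\<Sum>s\<in>Dest. (d' s - d s) * charged_trip d h s (d s) (h s))
      - (\<Sum>s\<in>Dest. (h' s - h s) * charged_business d h s (d s) (h s))) (at 0 within {0..1})"
proof -
  have affine: "((\<lambda>\<epsilon>. (1 - \<epsilon>) * y + \<epsilon> * y') has_real_derivative y' - y) (at 0 within {0..1})"
    for y y' :: real
    by (auto intro!: derivative_eq_intros)
  have "((\<lambda>\<epsilon>. smooth_cost (\<lambda>a. (1 - \<epsilon>) * x a + \<epsilon> * x' a) (\<lambda>s. (1 - \<epsilon>) * d s + \<epsilon> * d' s)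
        (\<lambda>s. (1 - \<epsilon>) * h s + \<epsilon> * h' s)) has_real_derivative
      (\<Sum>a\<in>arcs G. (x' a - x a) * t a (x a) + (x' a - x a) * deriv_nonneg (t a) (x a) * x a)
      - (\<Sum>s\<in>Dest. ((d' s - d s) * deriv_nonneg (\<lambda>y. A s y (h s)) (d s)
            + (h' s - h s) * deriv_nonneg (A s (d s)) (h s)) * d s + (d' s - d s) * A s (d s) (h s))
      - (\<Sum>s\<in>Dest. ((d' s - d s) * deriv_nonneg (\<lambda>y. B s y (h s)) (d s)
            + (h' s - h s) * deriv_nonneg (B s (d s)) (h s)) * h s + (h' s - h s) * B s (d s) (h s)))
      (at 0 within {0..1})"
    unfolding smooth_cost_def
    apply (intro DERIV_diff DERIV_sum)
    subgoal for a
      using DERIV_mult[OF affine DERIV_along_segment[OF t_diff]] assms by fastforce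
    subgoal for s
      using DERIV_mult[OF DERIV_along_segment2[OF A_diff] affine] assms by fastforce
    subgoal for s
      using DERIV_mult[OF DERIV_along_segment2[OF B_diff] affine] assms by fastforce
    done
  then show ?thesis
    by (rule DERIV_cong)
      (simp add: charged_time_def charged_trip_def charged_business_def road_price_def entry_charge_def
        company_charge_def algebra_simps sum.distrib sum_subtractf)
qed

text \<open>The three families of entropy terms (path flows, origin-destination demands, business
  flows) as one finite sum, to which \<open>entropy_minimum_on_segment\<close> applies.\<close>

definition entropy_index :: "('v \<times> 'v \<times> 'a awalk + 'v \<times> 'v + 'v) set" where
  "entropy_index = (SIGMA r:Orig. SIGMA s:Dest. routes G r s) <+> (Orig \<times> Dest <+> Dest)"

lemma finite_entropy_index: "finite entropy_index"
  unfolding entropy_index_def using finite_Orig finite_Dest finite_routes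
  by (intro finite_Plus finite_SigmaI) auto

lemma sum_entropy_index:
  "sum g entropy_index = (\<Sum>r\<in>Orig. \<Sum>s\<in>Dest. \<Sum>k\<in>routes G r s. g (Inl (r, s, k)))
     + (\<Sum>r\<in>Orig. \<Sum>s\<in>Dest. g (Inr (Inl (r, s)))) + (\<Sum>s\<in>Dest. g (Inr (Inr s)))"
  for g :: "'v \<times> 'v \<times> 'a awalk + 'v \<times> 'v + 'v \<Rightarrow> real"
proof -
  have fin: "finite (SIGMA s:Dest. routes G r s)" for r
    using finite_Dest finite_routes by auto
  show ?thesis
    unfolding entropy_index_def using finite_Orig finite_Dest finite_routes fin
    by (simp add: sum.Plus sum.Sigma sum.cartesian_product finite_Plus o_def case_prod_beta' add.assoc)
qed

definition entropy_weight :: "'v \<times> 'v \<times> 'a awalk + 'v \<times> 'v + 'v \<Rightarrow> real" where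
  "entropy_weight = case_sum (\<lambda>_. 1 / \<alpha>) (case_sum (\<lambda>_. 1 / \<gamma> - 1 / \<alpha>) (\<lambda>_. 1 / \<beta>))"

definition entropy_arg ::
    "('v \<Rightarrow> 'v \<Rightarrow> 'a awalk \<Rightarrow> real) \<Rightarrow> ('v \<Rightarrow> 'v \<Rightarrow> real) \<Rightarrow> ('v \<Rightarrow> real) \<Rightarrow>
     'v \<times> 'v \<times> 'a awalk + 'v \<times> 'v + 'v \<Rightarrow> real" where
  "entropy_arg f q h = case_sum (\<lambda>(r, s, k). f r s k) (case_sum (\<lambda>(r, s). q r s) h)"

lemma entropy_weight_nonneg: "0 \<le> entropy_weight i"
proof -
  have "1 / \<alpha> \<le> 1 / \<gamma>"
    using \<gamma>_pos \<gamma>_le_\<alpha> by (simp add: frac_le)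
  then show ?thesis
    using \<alpha>_pos \<beta>_pos by (auto simp: entropy_weight_def split: sum.split)
qed

lemma cost_entropy_form:
  "cost ((f, x, q, d), h) =
     (\<Sum>i\<in>entropy_index. entropy_weight i * (entropy_arg f q h i * (ln (entropy_arg f q h i) - 1))) + smooth_cost x d h"
  by (simp add: total_social_cost_def sum_entropy_index entropy_weight_def entropy_arg_def smooth_cost_def
      sum_distrib_left)

lemma entropy_arg_nonneg:
  assumes "((f, x, q, d), h) \<in> feasible" "i \<in> entropy_index"
  shows "0 \<le> entropy_arg f q h i"
  using assms flow_nonneg od_nonneg business_nonneg
  by (auto simp: entropy_index_def entropy_arg_def)

text \<open>The feasible set is convex, so the social cost along the segment from an optimum to any
  feasible point is minimal at the optimum.\<close>

lemma optimum_entropy: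
  assumes opt: "optimum ((f, x, q, d), h)" and w: "((f', x', q', d'), h') \<in> feasible"
  shows optimum_positive: "\<And>i. i \<in> entropy_index \<Longrightarrow> 0 < entropy_weight i \<Longrightarrow> 0 < entropy_arg f' q' h' i \<Longrightarrow>
      0 < entropy_arg f q h i"
    and optimum_variation: "(\<And>i. i \<in> entropy_index \<Longrightarrow> 0 < entropy_arg f q h i) \<Longrightarrow>
      0 \<le> (\<Sum>i\<in>entropy_index.
            entropy_weight i * ((entropy_arg f' q' h' i - entropy_arg f q h i) * ln (entropy_arg f q h i)))
        + ((\<Sum>a\<in>arcs G. (x' a - x a) * charged_time x a (x a))
          - (\<Sum>s\<in>Dest. (d' s - d s) * charged_trip d h s (d s) (h s))
          - (\<Sum>s\<in>Dest. (h' s - h s) * charged_business d h s (d s) (h s)))"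
proof -
  have z: "((f, x, q, d), h) \<in> feasible"
    using opt by (simp add: optimum_iff)
  let ?S = "\<lambda>\<epsilon>. smooth_cost (\<lambda>a. (1 - \<epsilon>) * x a + \<epsilon> * x' a) (\<lambda>s. (1 - \<epsilon>) * d s + \<epsilon> * d' s)
        (\<lambda>s. (1 - \<epsilon>) * h s + \<epsilon> * h' s)"
  let ?m = "\<lambda>\<epsilon> i. (1 - \<epsilon>) * entropy_arg f q h i + \<epsilon> * entropy_arg f' q' h' i"
  have mix_entropy_arg: "entropy_arg (\<lambda>r s k. (1 - \<epsilon>) * f r s k + \<epsilon> * f' r s k)
      (\<lambda>r s. (1 - \<epsilon>) * q r s + \<epsilon> * q' r s) (\<lambda>s. (1 - \<epsilon>) * h s + \<epsilon> * h' s) = ?m \<epsilon>" for \<epsilon>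
    by (auto simp: fun_eq_iff entropy_arg_def split: sum.split)
  have min: "(\<Sum>i\<in>entropy_index. entropy_weight i * (entropy_arg f q h i * (ln (entropy_arg f q h i) - 1))) + ?S 0
      \<le> (\<Sum>i\<in>entropy_index. entropy_weight i * (?m \<epsilon> i * (ln (?m \<epsilon> i) - 1))) + ?S \<epsilon>"
    if "0 < \<epsilon>" "\<epsilon> \<le> 1" for \<epsilon>
  proof -
    have "cost ((f, x, q, d), h) \<le> cost (mix \<epsilon> ((f, x, q, d), h) ((f', x', q', d'), h'))"
      using mix_feasible[OF z w, of \<epsilon>] opt that unfolding optimum_iff by (simp only: less_imp_le)
    then show ?thesis
      by (simp add: mix_def cost_entropy_form mix_entropy_arg)
  qed
  have S: "(?S has_real_derivative
      (\<Sum>a\<in>arcs G. (x' a - x a) * charged_time x a (x a))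
      - (\<Sum>s\<in>Dest. (d' s - d s) * charged_trip d h s (d s) (h s))
      - (\<Sum>s\<in>Dest. (h' s - h s) * charged_business d h s (d s) (h s))) (at 0 within {0..1})"
    using z w by (intro DERIV_smooth_cost) (auto intro: link_nonneg dest_nonneg business_nonneg)
  note args = finite_entropy_index entropy_weight_nonneg entropy_arg_nonneg[OF z] entropy_arg_nonneg[OF w] S min
  show "0 < entropy_arg f q h i" if "i \<in> entropy_index" "0 < entropy_weight i" "0 < entropy_arg f' q' h' i" for i
    by (rule entropy_minimum_positive[OF args that])
  show "0 \<le> (\<Sum>i\<in>entropy_index.
            entropy_weight i * ((entropy_arg f' q' h' i - entropy_arg f q h i) * ln (entropy_arg f q h i)))
        + ((\<Sum>a\<in>arcs G. (x' a - x a) * charged_time x a (x a))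
          - (\<Sum>s\<in>Dest. (d' s - d s) * charged_trip d h s (d s) (h s))
          - (\<Sum>s\<in>Dest. (h' s - h s) * charged_business d h s (d s) (h s)))"
    if "\<And>i. i \<in> entropy_index \<Longrightarrow> 0 < entropy_arg f q h i"
    by (rule entropy_minimum_variation[OF args that])
qed

section \<open>Stationarity implies the logit formulas\<close>

text \<open>The demands \<open>q r s\<close> are positive as sums of positive path flows; their own entropies do
  not suffice, since the coefficient \<open>1 / \<gamma> - 1 / \<alpha>\<close> vanishes if \<open>\<gamma> = \<alpha>\<close>.\<close>

lemma optimum_interior:
  assumes opt: "optimum ((f, x, q, d), h)"
  shows optimum_flow_pos: "r \<in> Orig \<Longrightarrow> s \<in> Dest \<Longrightarrow> k \<in> routes G r s \<Longrightarrow> 0 < f r s k"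
    and optimum_od_pos: "r \<in> Orig \<Longrightarrow> s \<in> Dest \<Longrightarrow> 0 < q r s"
    and optimum_business_pos: "s \<in> Dest \<Longrightarrow> 0 < h s"
proof -
  have K: "(f, x, q, d) \<in> K1 G Orig Dest Demand"
    using opt by (simp add: optimum_iff)
  note pos = optimum_positive[OF opt uniform_feasible[unfolded path_traffic_def]]
  show flow: "0 < f r s k" if "r \<in> Orig" "s \<in> Dest" "k \<in> routes G r s" for r s k
    using pos[of "Inl (r, s, k)"] that uniform_flow_pos[of r s] \<alpha>_pos
    by (simp add: entropy_index_def entropy_weight_def entropy_arg_def InlI InrI)
  show "0 < h s" if "s \<in> Dest"
    using pos[of "Inr (Inr s)"] that uniform_business_pos \<beta>_pos
    by (simp add: entropy_index_def entropy_weight_def entropy_arg_def InlI InrI)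
  show "0 < q r s" if "r \<in> Orig" "s \<in> Dest"
    unfolding flow_sum[OF K that, symmetric]
    using that by (intro sum_pos finite_routes routes_nonempty flow)
qed

text \<open>This and the following function are the partial derivatives of the social cost with
  respect to a path flow (with \<open>x\<close>, \<open>q\<close> and \<open>d\<close> depending on it) and to a business flow.\<close>

definition marginal_flow_cost ::
    "('a \<Rightarrow> real) \<Rightarrow> ('v \<Rightarrow> 'v \<Rightarrow> real) \<Rightarrow> ('v \<Rightarrow> real) \<Rightarrow> ('v \<Rightarrow> real) \<Rightarrow>
     ('v \<Rightarrow> 'v \<Rightarrow> 'a awalk \<Rightarrow> real) \<Rightarrow> 'v \<Rightarrow> 'v \<Rightarrow> 'a awalk \<Rightarrow> real" where
  "marginal_flow_cost x q d h f r s k =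
     1 / \<alpha> * ln (f r s k) + (1 / \<gamma> - 1 / \<alpha>) * ln (q r s)
     + route_cost G (charged_time x) x k - charged_trip d h s (d s) (h s)"

definition marginal_business_cost :: "('v \<Rightarrow> real) \<Rightarrow> ('v \<Rightarrow> real) \<Rightarrow> 'v \<Rightarrow> real" where
  "marginal_business_cost d h s = 1 / \<beta> * ln (h s) - charged_business d h s (d s) (h s)"

text \<open>The variational inequality in terms of the independent variables: the variations of \<open>x\<close>,
  \<open>q\<close> and \<open>d\<close> are linear in that of the path flows, and exchanging the order of summation
  collects the link costs along each route.\<close>

lemma optimum_marginal_costs:
  assumes opt: "optimum ((f, x, q, d), h)"
    and f': "\<And>r s k. r \<in> Orig \<Longrightarrow> s \<in> Dest \<Longrightarrow> k \<in> routes G r s \<Longrightarrow> 0 \<le> f' r s k"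
      "\<And>r. r \<in> Orig \<Longrightarrow> (\<Sum>s\<in>Dest. \<Sum>k\<in>routes G r s. f' r s k) = Demand r"
    and h': "h' \<in> K2 Dest T"
  shows "0 \<le> (\<Sum>r\<in>Orig. \<Sum>s\<in>Dest. \<Sum>k\<in>routes G r s.
        (f' r s k - f r s k) * marginal_flow_cost x q d h f r s k)
      + (\<Sum>s\<in>Dest. (h' s - h s) * marginal_business_cost d h s)"
proof -
  have K: "(f, x, q, d) \<in> K1 G Orig Dest Demand"
    using opt by (simp add: optimum_iff)
  obtain x' q' d' where p: "path_traffic f' = (f', x', q', d')"
    by (simp add: path_traffic_def)
  have K': "(f', x', q', d') \<in> K1 G Orig Dest Demand"
    using path_traffic_in_K1[OF f'] by (simp add: p)
  then have w: "((f', x', q', d'), h') \<in> feasible"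
    using h' by simp
  have "0 < entropy_arg f q h i" if "i \<in> entropy_index" for i
    using that optimum_interior[OF opt] by (auto simp: entropy_index_def entropy_arg_def)
  note var = optimum_variation[OF opt w this]
  define u where "u r s k = f' r s k - f r s k" for r s k
  define c where "c a = charged_time x a (x a)" for a
  define v where "v s = charged_trip d h s (d s) (h s)" for s
  have q: "q' r s - q r s = (\<Sum>k\<in>routes G r s. u r s k)" if "r \<in> Orig" "s \<in> Dest" for r s
    using flow_sum[OF K that] flow_sum[OF K' that] by (simp add: u_def sum_subtractf)
  have d: "d' s - d s = (\<Sum>r\<in>Orig. \<Sum>k\<in>routes G r s. u r s k)" if "s \<in> Dest" for s
    using dest_sum[OF K that] dest_sum[OF K' that] q that by (simp flip: q add: sum_subtractf)
  have x: "x' a - x a = (\<Sum>r\<in>Orig. \<Sum>s\<in>Dest. \<Sum>k\<in>routes G r s. incidence a k * u r s k)"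
    if "a \<in> arcs G" for a
    using link_sum[OF K that] link_sum[OF K' that]
    by (simp add: u_def sum_subtractf right_diff_distrib)
  have "(\<Sum>a\<in>arcs G. (x' a - x a) * c a)
      = (\<Sum>a\<in>arcs G. \<Sum>r\<in>Orig. \<Sum>s\<in>Dest. \<Sum>k\<in>routes G r s. u r s k * (incidence a k * c a))"
    by (simp add: x sum_distrib_left sum_distrib_right mult_ac)
  also have "\<dots> = (\<Sum>r\<in>Orig. \<Sum>s\<in>Dest. \<Sum>k\<in>routes G r s. \<Sum>a\<in>arcs G. u r s k * (incidence a k * c a))"
    by (simp only: sum.swap[where A = "arcs G"])
  also have "\<dots> = (\<Sum>r\<in>Orig. \<Sum>s\<in>Dest. \<Sum>k\<in>routes G r s. u r s k * route_cost G (charged_time x) x k)"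
    by (simp add: route_cost_def c_def sum_distrib_left)
  finally have x_sum: "(\<Sum>a\<in>arcs G. (x' a - x a) * c a) = \<dots>" .
  have "(\<Sum>s\<in>Dest. (d' s - d s) * v s)
      = (\<Sum>s\<in>Dest. \<Sum>r\<in>Orig. \<Sum>k\<in>routes G r s. u r s k * v s)"
    by (simp add: d sum_distrib_right)
  also have "\<dots> = (\<Sum>r\<in>Orig. \<Sum>s\<in>Dest. \<Sum>k\<in>routes G r s. u r s k * v s)"
    by (rule sum.swap)
  finally have d_sum: "(\<Sum>s\<in>Dest. (d' s - d s) * v s) = \<dots>" .
  have q_sum: "(\<Sum>r\<in>Orig. \<Sum>s\<in>Dest. (1 / \<gamma> - 1 / \<alpha>) * ((q' r s - q r s) * ln (q r s)))
      = (\<Sum>r\<in>Orig. \<Sum>s\<in>Dest. \<Sum>k\<in>routes G r s. u r s k * ((1 / \<gamma> - 1 / \<alpha>) * ln (q r s)))"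
    by (simp add: q sum_distrib_right sum_distrib_left mult_ac)
  have flow_terms: "(\<Sum>r\<in>Orig. \<Sum>s\<in>Dest. \<Sum>k\<in>routes G r s. u r s k * marginal_flow_cost x q d h f r s k)
      = (\<Sum>r\<in>Orig. \<Sum>s\<in>Dest. \<Sum>k\<in>routes G r s. 1 / \<alpha> * (u r s k * ln (f r s k)))
      + (\<Sum>r\<in>Orig. \<Sum>s\<in>Dest. \<Sum>k\<in>routes G r s. u r s k * ((1 / \<gamma> - 1 / \<alpha>) * ln (q r s)))
      + (\<Sum>r\<in>Orig. \<Sum>s\<in>Dest. \<Sum>k\<in>routes G r s. u r s k * route_cost G (charged_time x) x k)
      - (\<Sum>r\<in>Orig. \<Sum>s\<in>Dest. \<Sum>k\<in>routes G r s. u r s k * v s)"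
    unfolding marginal_flow_cost_def v_def[symmetric] distrib_left right_diff_distrib
      sum.distrib sum_subtractf mult.left_commute[of "1 / \<alpha>"] by simp
  have business_terms: "(\<Sum>s\<in>Dest. (h' s - h s) * marginal_business_cost d h s)
      = (\<Sum>s\<in>Dest. 1 / \<beta> * ((h' s - h s) * ln (h s)))
      - (\<Sum>s\<in>Dest. (h' s - h s) * charged_business d h s (d s) (h s))"
    unfolding marginal_business_cost_def right_diff_distrib
      sum_subtractf mult.left_commute[of "1 / \<beta>"] by simp
  show ?thesis
    using var
    unfolding sum_entropy_index entropy_weight_def entropy_arg_def sum.case prod.case
      u_def[symmetric] c_def[symmetric] v_def[symmetric] q_sum x_sum d_sum flow_terms business_terms
    by linarith
qed

text \<open>The total demand of each origin is fixed while destinations and routes are free, so the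
  path flows from one origin form a simplex over all pairs of a destination and a route.\<close>

lemma optimum_flow_stationary:
  assumes opt: "optimum ((f, x, q, d), h)" and r: "r \<in> Orig"
  obtains \<mu> where
    "\<And>s k. s \<in> Dest \<Longrightarrow> k \<in> routes G r s \<Longrightarrow> marginal_flow_cost x q d h f r s k = \<mu>"
proof -
  have K: "(f, x, q, d) \<in> K1 G Orig Dest Demand" "h \<in> K2 Dest T"
    using opt by (simp_all add: optimum_iff)
  let ?J = "SIGMA s:Dest. routes G r s"
  let ?y = "\<lambda>(s, k). f r s k" and ?g = "\<lambda>(s, k). marginal_flow_cost x q d h f r s k"
  have sum_J: "sum F ?J = (\<Sum>s\<in>Dest. \<Sum>k\<in>routes G r s. F (s, k))" for F :: "'v \<times> 'a awalk \<Rightarrow> real"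
    using finite_Dest finite_routes by (simp add: sum.Sigma)
  obtain \<mu> where \<mu>: "\<And>j. j \<in> ?J \<Longrightarrow> ?g j = \<mu>"
  proof (rule simplex_stationary[of ?J ?y ?g])
    show "finite ?J"
      using finite_Dest finite_routes by auto
    show "0 < ?y j" if "j \<in> ?J" for j
      using that optimum_flow_pos[OF opt r] by auto
    fix y'
    assume y': "\<And>j. j \<in> ?J \<Longrightarrow> 0 \<le> y' j" "sum y' ?J = sum ?y ?J"
    define f' where "f' = (\<lambda>r' s k. if r' = r then y' (s, k) else f r' s k)"
    have "0 \<le> f' r' s k" if "r' \<in> Orig" "s \<in> Dest" "k \<in> routes G r' s" for r' s k
      using that y'(1) flow_nonneg[OF K(1)] by (auto simp: f'_def)
    moreover have "(\<Sum>s\<in>Dest. \<Sum>k\<in>routes G r' s. f' r' s k) = Demand r'" if "r' \<in> Orig" for r'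
    proof (cases "r' = r")
      case True
      then show ?thesis
        using y'(2) r by (simp add: f'_def sum_J flow_sum[OF K(1)] od_sum[OF K(1)])
    next
      case False
      then show ?thesis
        using that by (simp add: f'_def flow_sum[OF K(1)] od_sum[OF K(1)])
    qed
    ultimately have "0 \<le> (\<Sum>r'\<in>Orig. \<Sum>s\<in>Dest. \<Sum>k\<in>routes G r' s.
          (f' r' s k - f r' s k) * marginal_flow_cost x q d h f r' s k)"
      using optimum_marginal_costs[OF opt _ _ K(2), of f'] by simp
    also have "\<dots> = (\<Sum>r'\<in>Orig. if r' = r then \<Sum>j\<in>?J. (y' j - ?y j) * ?g j else 0)"
      by (intro sum.cong) (auto simp: f'_def sum_J)
    also have "\<dots> = (\<Sum>j\<in>?J. (y' j - ?y j) * ?g j)"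
      using finite_Orig r by simp
    finally show "0 \<le> (\<Sum>j\<in>?J. (y' j - ?y j) * ?g j)" .
  qed blast
  show thesis
    by (rule that[of \<mu>]) (use \<mu> in fastforce)
qed

lemma optimum_business_stationary:
  assumes opt: "optimum ((f, x, q, d), h)"
  obtains \<mu> where "\<And>s. s \<in> Dest \<Longrightarrow> marginal_business_cost d h s = \<mu>"
proof (rule simplex_stationary[of Dest h "marginal_business_cost d h"])
  have K: "(f, x, q, d) \<in> K1 G Orig Dest Demand" "h \<in> K2 Dest T"
    using opt by (simp_all add: optimum_iff)
  show "0 \<le> (\<Sum>s\<in>Dest. (h' s - h s) * marginal_business_cost d h s)"
    if "\<And>s. s \<in> Dest \<Longrightarrow> 0 \<le> h' s" "sum h' Dest = sum h Dest" for h'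
    using optimum_marginal_costs[OF opt, of f h'] that business_sum[OF K(2)]
      flow_nonneg[OF K(1)] flow_sum[OF K(1)] od_sum[OF K(1)]
    by (simp add: K2_def)
qed (use finite_Dest optimum_business_pos[OF opt] in auto)

text \<open>Solving the stationarity condition for \<open>f r s k\<close> makes it proportional to
  \<open>exp (- \<alpha> * c k)\<close> among the routes to \<open>s\<close>, which is the route choice formula. Summing over
  these routes produces \<open>exp (- \<alpha> * v r s)\<close>; the entropy of \<open>q\<close> changes the exponent \<open>\<alpha>\<close> to \<open>\<gamma>\<close>,
  which gives the destination choice formula.\<close>

lemma optimum_is_equilibrium:
  assumes opt: "optimum ((f, x, q, d), h)"
  shows "combined_equilibrium G Orig Dest Demand T \<alpha> \<beta> \<gamma>
    (charged_time x) (charged_trip d h) (charged_business d h) ((f, x, q, d), h)"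
proof -
  have K: "(f, x, q, d) \<in> K1 G Orig Dest Demand" "h \<in> K2 Dest T"
    using opt by (simp_all add: optimum_iff)
  define c where "c = route_cost G (charged_time x) x"
  define v where "v = od_cost G \<alpha> (charged_time x) x"
  define A' where "A' = (\<lambda>s. charged_trip d h s (d s) (h s))"
  define B' where "B' = (\<lambda>s. charged_business d h s (d s) (h s))"
  have q_f: "q r s = Demand r * (exp (- \<gamma> * (v r s - A' s)) / (\<Sum>j\<in>Dest. exp (- \<gamma> * (v r j - A' j)))) \<and>
      (\<forall>k\<in>routes G r s. f r s k =
        q r s * (exp (- \<alpha> * c k) / (\<Sum>j\<in>routes G r s. exp (- \<alpha> * c j))))"
    if r: "r \<in> Orig" and s: "s \<in> Dest" for r s
  proof -
    obtain \<mu> where \<mu>: "\<And>s k. s \<in> Dest \<Longrightarrow> k \<in> routes G r s \<Longrightarrow> marginal_flow_cost x q d h f r s k = \<mu>"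
      using optimum_flow_stationary[OF opt r] by blast
    \<comment> \<open>the factor of \<open>f r s k\<close> common to all routes from \<open>r\<close> to \<open>s\<close>\<close>
    define C where "C = (\<lambda>s. \<alpha> * (\<mu> + A' s) - (\<alpha> / \<gamma> - 1) * ln (q r s))"
    have f: "f r s k = exp (C s) * exp (- \<alpha> * c k)" if s: "s \<in> Dest" and k: "k \<in> routes G r s" for s k
    proof -
      have "\<alpha> * \<mu> = \<alpha> * marginal_flow_cost x q d h f r s k"
        using \<mu> that by simp
      also have "\<dots> = ln (f r s k) + (\<alpha> / \<gamma> - 1) * ln (q r s) + \<alpha> * c k - \<alpha> * A' s"
        using \<alpha>_pos by (simp add: marginal_flow_cost_def c_def A'_def algebra_simps)
      finally have "ln (f r s k) = C s + (- \<alpha> * c k)"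
        by (simp add: C_def algebra_simps)
      then show ?thesis
        using exp_ln[OF optimum_flow_pos[OF opt r that]] by (simp only: exp_add)
    qed
    have q: "q r s = exp (\<gamma> * \<mu>) * exp (- \<gamma> * (v r s - A' s))" if s: "s \<in> Dest" for s
    proof -
      let ?E = "\<Sum>k\<in>routes G r s. exp (- \<alpha> * c k)"
      have "0 < ?E"
        using routes_nonempty[OF r s] finite_routes by (intro sum_pos) auto
      have "q r s = exp (C s) * ?E"
        using f s by (simp add: sum_distrib_left flip: flow_sum[OF K(1) r s])
      then have "ln (q r s) = C s + ln ?E"
        using \<open>0 < ?E\<close> by (simp add: ln_mult)
      also have "ln ?E = - \<alpha> * v r s"
        using \<alpha>_pos by (simp add: v_def od_cost_def c_def)
      finally have "\<alpha> / \<gamma> * ln (q r s) = \<alpha> * (\<mu> + A' s - v r s)"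
        by (simp add: C_def algebra_simps)
      then have "\<alpha> * ln (q r s) = \<alpha> * (\<gamma> * (\<mu> + A' s - v r s))"
        using \<gamma>_pos by (simp add: field_simps)
      then have "ln (q r s) = \<gamma> * (\<mu> + A' s - v r s)"
        using \<alpha>_pos by simp
      then have "ln (q r s) = \<gamma> * \<mu> + (- \<gamma> * (v r s - A' s))"
        by (simp add: algebra_simps)
      then show ?thesis
        using exp_ln[OF optimum_od_pos[OF opt r s]] by (simp only: exp_add)
    qed
    show ?thesis
      using logit_share[OF finite_Dest od_sum[OF K(1) r] q s]
        logit_share[OF finite_routes flow_sum[OF K(1) r s] f[OF s]] by blast
  qed
  have h: "h s = T * (exp (\<beta> * B' s) / (\<Sum>j\<in>Dest. exp (\<beta> * B' j)))" if s: "s \<in> Dest" for s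
  proof -
    obtain \<mu> where \<mu>: "\<And>s. s \<in> Dest \<Longrightarrow> marginal_business_cost d h s = \<mu>"
      using optimum_business_stationary[OF opt] by blast
    have "h s = exp (\<beta> * \<mu>) * exp (\<beta> * B' s)" if "s \<in> Dest" for s
    proof -
      have "ln (h s) = \<beta> * \<mu> + \<beta> * B' s"
        using \<mu>[OF that] \<beta>_pos by (simp add: marginal_business_cost_def B'_def field_simps)
      then show ?thesis
        using exp_ln[OF optimum_business_pos[OF opt that]] by (simp only: exp_add)
    qed
    then show ?thesis
      by (rule logit_share[OF finite_Dest business_sum[OF K(2)] _ s])
  qed
  show ?thesis
    using K q_f h
    unfolding combined_equilibrium_def prod.case c_def v_def A'_def B'_def by blast
qed

end

section \<open>The pricing theorem\<close>

theorem mainTheorem8: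
  fixes G :: "('v, 'a) pre_digraph"
    and Orig Dest :: "'v set"
    and Demand :: "'v \<Rightarrow> real"
    and T \<alpha> \<beta> \<gamma> :: real
    and t :: "'a \<Rightarrow> real \<Rightarrow> real"
    and A B :: "'v \<Rightarrow> real \<Rightarrow> real \<Rightarrow> real"
  assumes "fin_digraph G"
    and "Orig \<subseteq> verts G" and "Orig \<noteq> {}"
    and "Dest \<subseteq> verts G" and "Dest \<noteq> {}"
    and "\<And>r s. r \<in> Orig \<Longrightarrow> s \<in> Dest \<Longrightarrow> routes G r s \<noteq> {}"
    and "\<And>r. r \<in> Orig \<Longrightarrow> 0 < Demand r"
    and "0 < T"
    and "0 < \<alpha>" and "0 < \<beta>" and "0 < \<gamma>" and "\<gamma> \<le> \<alpha>"
    and "\<And>a. a \<in> arcs G \<Longrightarrow> link_travel_time (t a)"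
    and "\<And>s. s \<in> Dest \<Longrightarrow> trip_attraction (A s)"
    and "\<And>s. s \<in> Dest \<Longrightarrow> business_attraction (B s)"
  shows "(\<exists>z. system_optimum G Orig Dest Demand T \<alpha> \<beta> \<gamma> t A B z) \<and>
    (\<forall>f x q d h. system_optimum G Orig Dest Demand T \<alpha> \<beta> \<gamma> t A B ((f, x, q, d), h) \<longrightarrow>
       combined_equilibrium G Orig Dest Demand T \<alpha> \<beta> \<gamma>
         (\<lambda>a y. t a y + road_price t x a)
         (\<lambda>s y z. A s y z - entry_charge A B d h s)
         (\<lambda>s y z. B s y z - company_charge A B d h s)
         ((f, x, q, d), h))"
proof -
  interpret logit_network G Orig Dest Demand T \<alpha> \<beta> \<gamma> t A B
    using assms
    by (intro logit_network.intro logit_network_axioms.intro)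
      (simp_all add: link_travel_time_def trip_attraction_def business_attraction_def)
  show ?thesis
    using optimum_exists optimum_is_equilibrium
    unfolding charged_time_def charged_trip_def charged_business_def by blast
qed

end
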